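(* $\mathrm{AO}(M)$ and $\mathrm{AO}(N)$ are closed in $\mathrm{TO}(M)$ and $\mathrm{TO}(N)$, respectively, and hence compact.
   Context: $K$ is a field, $K[X]=K[X_1,\dots,X_t]$ the commutative polynomial ring in $t$ indeterminates, $M=\{X^\nu\mid\nu\in\mathbb{N}_0^t\}$ its set of monomials. $A$ is an associative, not necessarily commutative $K$-algebra with a fixed $K$-module isomorphism $\Phi:A\to K[X]$ (not necessarily multiplicative), and $N=\Phi^{-1}(M)$. For a set $S$, $\mathrm{TO}(S)$ is the set of all total orderings on $S$ (antisymmetric, transitive, total binary relations), with the coarsest topology for which all sets $\mathfrak{U}_{(a,b)}=\{{\preceq}\in\mathrm{TO}(S)\mid a\preceq b\}$ are open; subsets carry the relative topology. Let $\phi:\mathrm{TO}(N)\to\mathrm{TO}(M)$ be the bijection given by $\Phi(n)\,\phi({\preceq})\,\Phi(n')\Leftrightarrow n\preceq n'$. $\mathrm{AO}(M)$ (admissible orderings) is the set of ${\leq}\in\mathrm{TO}(M)$ with $1\leq X^\nu$ for all $\nu\in\mathbb{N}_0^t$ and $X^\upsilon\leq X^\nu\Rightarrow X^{\upsilon+\gamma}\leq X^{\nu+\gamma}$ for all $\upsilon,\nu,\gamma\in\mathbb{N}_0^t$. $\mathrm{AO}(N)=\phi^{-1}(\mathrm{AO}(M))$. *)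

theory Defs
  imports "HOL-Analysis.Analysis" "HOL-Library.Poly_Mapping"
begin

subsection \<open>The space of total orderings on a set\<close>

text \<open>Orderings are relations contained in \<open>S \<times> S\<close>; being reflexive and total on \<open>S\<close>
  together says that any two (possibly equal) elements of \<open>S\<close> are comparable.\<close>

definition TO :: "'a set \<Rightarrow> 'a rel set" where
  "TO S = {r. linear_order_on S r}"

definition TO_sub :: "'a set \<Rightarrow> 'a \<Rightarrow> 'a \<Rightarrow> 'a rel set" where
  "TO_sub S a b = {r \<in> TO S. (a, b) \<in> r}"

text \<open>\<open>TO S\<close> itself is listed as a generator only so that the carrier is also right for
  \<open>S = {}\<close>; otherwise it equals \<open>TO_sub S a a\<close> for any \<open>a \<in> S\<close>.\<close>

definition TO_top :: "'a set \<Rightarrow> 'a rel topology" where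
  "TO_top S = topology_generated_by (insert (TO S) {TO_sub S a b |a b. a \<in> S \<and> b \<in> S})"

lemma topspace_TO_top [simp]: "topspace (TO_top S) = TO S"
  unfolding TO_top_def topology_generated_by_topspace by (auto simp: TO_sub_def)


subsection \<open>Polynomials in finitely many indeterminates\<close>

text \<open>An exponent vector in \<open>\<nat>\<^sub>0\<^sup>t\<close> is a finitely supported function on \<open>nat\<close> vanishing outside
  \<open>{1..t}\<close>, and a polynomial is a finitely supported function from exponent vectors to
  coefficients; the convolution product of \<^theory>\<open>HOL-Library.Poly_Mapping\<close> is polynomial
  multiplication.\<close>

type_synonym 'k mpol = "(nat \<Rightarrow>\<^sub>0 nat) \<Rightarrow>\<^sub>0 'k"

definition exps :: "nat \<Rightarrow> (nat \<Rightarrow>\<^sub>0 nat) set" where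
  "exps t = {\<nu>. Poly_Mapping.keys \<nu> \<subseteq> {1..t}}"

definition pol_ring :: "nat \<Rightarrow> 'k::field mpol set" where
  "pol_ring t = {p. Poly_Mapping.keys p \<subseteq> exps t}"

definition pol_scale :: "'k::field \<Rightarrow> 'k mpol \<Rightarrow> 'k mpol" where
  "pol_scale c p = Poly_Mapping.single 0 c * p"

definition Xpow :: "(nat \<Rightarrow>\<^sub>0 nat) \<Rightarrow> 'k::field mpol" where
  "Xpow \<nu> = Poly_Mapping.single \<nu> 1"

definition monoms :: "nat \<Rightarrow> 'k::field mpol set" where
  "monoms t = Xpow ` exps t"

lemma Xpow_0: "Xpow 0 = 1"
  by (simp add: Xpow_def)

lemma Xpow_add: "Xpow (\<upsilon> + \<nu>) = Xpow \<upsilon> * Xpow \<nu>"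
  by (simp add: Xpow_def mult_single)

lemma vector_space_pol_scale: "vector_space pol_scale"
  by unfold_locales
    (simp_all add: pol_scale_def algebra_simps single_add mult_single flip: mult.assoc)


subsection \<open>Algebras with a fixed linear isomorphism to the polynomial ring\<close>

text \<open>Associativity, without commutativity or a unit, comes from the class \<^class>\<open>ring\<close>.\<close>

locale assoc_algebra = vector_space scale
  for scale :: "'k::field \<Rightarrow> 'a::ring \<Rightarrow> 'a" +
  assumes scale_mult_left: "scale c x * y = scale c (x * y)"
    and scale_mult_right: "x * scale c y = scale c (x * y)"

text \<open>The codomain of \<open>\<Phi>\<close> is the subspace \<open>pol_ring t\<close> of the type of polynomials in countably
  many indeterminates.\<close>

locale algebra_with_pol_iso = assoc_algebra scale
  for scale :: "'k::field \<Rightarrow> 'a::ring \<Rightarrow> 'a" +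
  fixes t :: nat and \<Phi> :: "'a \<Rightarrow> 'k mpol"
  assumes hom: "module_hom scale pol_scale \<Phi>"
    and bij: "bij_betw \<Phi> UNIV (pol_ring t)"

definition basisN :: "nat \<Rightarrow> ('a \<Rightarrow> 'k::field mpol) \<Rightarrow> 'a set" where
  "basisN t \<Phi> = \<Phi> -` monoms t"

text \<open>For injective \<open>\<Phi>\<close> this is the relation \<open>r'\<close> on the image of \<open>\<Phi>\<close> with
  \<open>(\<Phi> n, \<Phi> n') \<in> r' \<longleftrightarrow> (n, n') \<in> r\<close>.\<close>

definition transport :: "('a \<Rightarrow> 'b) \<Rightarrow> 'a rel \<Rightarrow> 'b rel" where
  "transport \<Phi> r = {(\<Phi> n, \<Phi> n') |n n'. (n, n') \<in> r}"

lemma transport_iff: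
  assumes "inj \<Phi>"
  shows "(\<Phi> n, \<Phi> n') \<in> transport \<Phi> r \<longleftrightarrow> (n, n') \<in> r"
  using assms by (auto simp: transport_def dest: injD)


subsection \<open>Admissible orderings\<close>

definition AO_M :: "nat \<Rightarrow> 'k::field mpol rel set" where
  "AO_M t = {r \<in> TO (monoms t).
     (\<forall>\<nu>\<in>exps t. (1, Xpow \<nu>) \<in> r) \<and>
     (\<forall>\<upsilon>\<in>exps t. \<forall>\<nu>\<in>exps t. \<forall>\<gamma>\<in>exps t.
        (Xpow \<upsilon>, Xpow \<nu>) \<in> r \<longrightarrow> (Xpow (\<upsilon> + \<gamma>), Xpow (\<nu> + \<gamma>)) \<in> r)}"

definition AO_N :: "nat \<Rightarrow> ('a \<Rightarrow> 'k::field mpol) \<Rightarrow> 'a rel set" where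
  "AO_N t \<Phi> = {r \<in> TO (basisN t \<Phi>). transport \<Phi> r \<in> AO_M t}"

end

theory Submission
  imports Defs
begin

text \<open>In a total ordering, (a, b) fails for distinct a, b exactly when (b, a) holds, so every
  subbasic open set of \<open>TO_top S\<close> is also closed. Hence any property that is a
  universally quantified finite Boolean combination of conditions "(a, b) lies in the ordering"
  defines a closed set. Admissibility has this shape, which gives \<open>closedin_AO_M\<close>.

  Compactness comes from \<open>compact_space_TO_top\<close>: the order axioms have the same shape,
  so the characteristic functions of total orderings form a closed subset of the cube {False,
  True}^(S x S), which is compact by Tychonoff, and decoding them into relations is continuous.

  The passage from M to N is \<open>continuous_map_transport\<close>: AO(N) is the preimage of AO(M)
  under a continuous map. Closed subsets of compact spaces are compact.\<close>

text \<open>Apart from containment in \<open>S \<times> S\<close>, the order axioms become bounded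
  quantifiers over membership of single pairs, the form to which the closure rules below apply.
  Reflexivity is the case \<open>a = b\<close> of comparability.\<close>

lemma TO_iff:
  "r \<in> TO S \<longleftrightarrow> r \<subseteq> S \<times> S \<and>
     (\<forall>a\<in>S. \<forall>b\<in>S. (a, b) \<in> r \<or> (b, a) \<in> r) \<and>
     (\<forall>a\<in>S. \<forall>b\<in>S. a \<noteq> b \<longrightarrow> (a, b) \<notin> r \<or> (b, a) \<notin> r) \<and>
     (\<forall>a\<in>S. \<forall>b\<in>S. \<forall>c\<in>S. (a, b) \<in> r \<longrightarrow> (b, c) \<in> r \<longrightarrow> (a, c) \<in> r)"
  (is "?L \<longleftrightarrow> ?R")
proof
  assume ?L
  then have r: "r \<subseteq> S \<times> S" "refl_on S r" "trans r" "antisym r" "total_on S r"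
    by (auto simp: TO_def linear_order_on_def partial_order_on_def preorder_on_def)
  have "\<forall>a\<in>S. \<forall>b\<in>S. (a, b) \<in> r \<or> (b, a) \<in> r"
    using r(2,5) unfolding refl_on_def total_on_def by metis
  moreover have "\<forall>a\<in>S. \<forall>b\<in>S. a \<noteq> b \<longrightarrow> (a, b) \<notin> r \<or> (b, a) \<notin> r"
    by (blast dest: antisymD[OF r(4)])
  moreover have "\<forall>a\<in>S. \<forall>b\<in>S. \<forall>c\<in>S. (a, b) \<in> r \<longrightarrow> (b, c) \<in> r \<longrightarrow> (a, c) \<in> r"
    by (intro ballI impI) (rule transD[OF r(3)])
  ultimately show ?R
    using r(1) by (intro conjI)
next
  assume R: ?R
  note sub = R[THEN conjunct1]
    and tot = R[THEN conjunct2, THEN conjunct1, rule_format]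
    and anti = R[THEN conjunct2, THEN conjunct2, THEN conjunct1, rule_format]
    and tr = R[THEN conjunct2, THEN conjunct2, THEN conjunct2, rule_format]
  have "refl_on S r" "total_on S r"
    using tot by (auto simp: refl_on_def total_on_def)
  moreover have "trans r"
  proof (rule transI)
    fix a b c
    assume ab: "(a, b) \<in> r" and bc: "(b, c) \<in> r"
    with sub have "a \<in> S" "b \<in> S" "c \<in> S"
      by auto
    then show "(a, c) \<in> r"
      using ab bc by (rule tr)
  qed
  moreover have "antisym r"
  proof (rule antisymI)
    fix a b
    assume "(a, b) \<in> r" "(b, a) \<in> r"
    with sub anti[of a b] show "a = b"
      by auto
  qed
  ultimately show ?L
    using sub by (simp add: TO_def linear_order_on_def partial_order_on_def preorder_on_def)
qed

text \<open>This rule and the next two let closedness be proved along the syntax of a formula: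
  arbitrary intersections for bounded quantifiers, finite unions for disjunctions. An empty
  \<open>I\<close> is separate because the set is then the whole space, not an empty
  intersection.\<close>

lemma closedin_Ball:
  assumes "\<And>i. i \<in> I \<Longrightarrow> closedin T {x \<in> topspace T. P i x}"
  shows "closedin T {x \<in> topspace T. \<forall>i\<in>I. P i x}"
proof (cases "I = {}")
  case False
  then have "{x \<in> topspace T. \<forall>i\<in>I. P i x} = (\<Inter>i\<in>I. {x \<in> topspace T. P i x})"
    by auto
  with False assms show ?thesis
    by auto
qed simp

lemma closedin_conj:
  assumes "closedin T {x \<in> topspace T. P x}" "closedin T {x \<in> topspace T. Q x}"
  shows "closedin T {x \<in> topspace T. P x \<and> Q x}"
  using closedin_Int[OF assms] by (rule back_subst[of "closedin T"]) auto

lemma closedin_disj: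
  assumes "closedin T {x \<in> topspace T. P x}" "closedin T {x \<in> topspace T. Q x}"
  shows "closedin T {x \<in> topspace T. P x \<or> Q x}"
  using closedin_Un[OF assms] by (rule back_subst[of "closedin T"]) auto

lemma openin_TO_sub: "a \<in> S \<Longrightarrow> b \<in> S \<Longrightarrow> openin (TO_top S) (TO_sub S a b)"
  unfolding TO_top_def by (rule topology_generated_by_Basis) auto

text \<open>Totality and antisymmetry make \<open>TO_sub S b a\<close> the complement of
  \<open>TO_sub S a b\<close> when \<open>a \<noteq> b\<close>; for \<open>a = b\<close> reflexivity
  makes the first set all of \<open>TO S\<close> and the second one empty.\<close>

lemma
  assumes "a \<in> S" "b \<in> S"
  shows closedin_TO_mem: "closedin (TO_top S) {r \<in> topspace (TO_top S). (a, b) \<in> r}"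
    and closedin_TO_not_mem: "closedin (TO_top S) {r \<in> topspace (TO_top S). (a, b) \<notin> r}"
proof -
  have "(a, b) \<in> r \<longleftrightarrow> a = b \<or> (b, a) \<notin> r" if "r \<in> TO S" for r
    using that assms unfolding TO_iff by metis
  then have eq: "{r \<in> TO S. (a, b) \<in> r} = TO S - (if a = b then {} else TO_sub S b a)"
    by (auto simp: TO_sub_def)
  show "closedin (TO_top S) {r \<in> topspace (TO_top S). (a, b) \<in> r}"
    unfolding topspace_TO_top eq using openin_TO_sub[OF assms(2,1)]
    by (auto simp: closedin_def double_diff TO_sub_def)
  have eq': "{r \<in> TO S. (a, b) \<notin> r} = TO S - TO_sub S a b"
    by (auto simp: TO_sub_def)
  show "closedin (TO_top S) {r \<in> topspace (TO_top S). (a, b) \<notin> r}"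
    unfolding topspace_TO_top eq' using openin_TO_sub[OF assms]
    by (auto simp: closedin_def double_diff TO_sub_def)
qed

text \<open>\<open>TO S\<close> is the continuous image of a closed subset of the Tychonoff cube
  \<open>{False, True}\<^bsup>S \<times> S\<^esup>\<close>.\<close>

lemma compact_space_TO_top: "compact_space (TO_top S)"
proof -
  define P where "P = product_topology (\<lambda>_. discrete_topology (UNIV :: bool set)) (S \<times> S)"
  define rel where "rel f = {p \<in> S \<times> S. f p}" for f :: "'a \<times> 'a \<Rightarrow> bool"
  define C where "C = {f \<in> topspace P. rel f \<in> TO S}"
  have topP: "topspace P = (S \<times> S) \<rightarrow>\<^sub>E UNIV"
    by (simp add: P_def)
  have cP: "compact_space P"
    unfolding P_def by (simp add: compact_space_product_topology compact_space_discrete_topology)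
  have proj: "continuous_map P (discrete_topology UNIV) (\<lambda>f. f p)" if "p \<in> S \<times> S" for p
    unfolding P_def using that by (rule continuous_map_product_projection)
  have opn: "openin P {f \<in> topspace P. p \<in> rel f}" if "p \<in> S \<times> S" for p
    using openin_continuous_map_preimage[OF proj[OF that], of "{True}"] that
    by (simp add: rel_def)
  have cl: "closedin P {f \<in> topspace P. p \<in> rel f}" if "p \<in> S \<times> S" for p
    using closedin_continuous_map_preimage[OF proj[OF that], of "{True}"] that
    by (simp add: rel_def)
  have ncl: "closedin P {f \<in> topspace P. p \<notin> rel f}" if "p \<in> S \<times> S" for p
    using closedin_continuous_map_preimage[OF proj[OF that], of "{False}"] that
    by (simp add: rel_def)
  \<comment> \<open>This handles the disjunct \<open>a = b\<close> of antisymmetry, which does not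
    depend on \<open>f\<close>.\<close>
  have const: "closedin P {f \<in> topspace P. Q}" for Q
    by (cases Q) auto
  \<comment> \<open>These are the axioms of \<open>TO_iff\<close> with implications written as
    disjunctions; the containment axiom holds for every \<open>rel f\<close> by
    construction.\<close>
  have "closedin P {f \<in> topspace P.
     (\<forall>a\<in>S. \<forall>b\<in>S. (a, b) \<in> rel f \<or> (b, a) \<in> rel f) \<and>
     (\<forall>a\<in>S. \<forall>b\<in>S. a = b \<or> (a, b) \<notin> rel f \<or> (b, a) \<notin> rel f) \<and>
     (\<forall>a\<in>S. \<forall>b\<in>S. \<forall>c\<in>S. (a, b) \<notin> rel f \<or> (b, c) \<notin> rel f \<or> (a, c) \<in> rel f)}"
    by (intro closedin_conj closedin_Ball closedin_disj cl ncl const) auto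
  moreover have "rel f \<subseteq> S \<times> S" for f
    by (auto simp: rel_def)
  ultimately have "closedin P C"
    unfolding C_def TO_iff imp_conv_disj not_not by simp
  with cP have "compactin P C"
    by (rule closedin_compact_space)
  moreover have "continuous_map (subtopology P C) (TO_top S) rel"
    unfolding TO_top_def
  \<comment> \<open>Only generators need checking: the preimage of \<open>TO_sub S a b\<close> is an
    open condition on the single coordinate \<open>(a, b)\<close>, cut down to
    \<open>C\<close>.\<close>
  proof (rule continuous_on_generated_topo)
    fix U
    assume "U \<in> insert (TO S) {TO_sub S a b |a b. a \<in> S \<and> b \<in> S}"
    then consider "U = TO S" | a b where "a \<in> S" "b \<in> S" "U = TO_sub S a b"
      by auto
    then show "openin (subtopology P C) (rel -` U \<inter> topspace (subtopology P C))"
    proof cases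
      case 1
      then have "rel -` U \<inter> topspace (subtopology P C) = topspace (subtopology P C)"
        by (auto simp: C_def)
      then show ?thesis
        by (metis openin_topspace)
    next
      case 2
      then have "rel -` U \<inter> topspace (subtopology P C) = {f \<in> topspace P. (a, b) \<in> rel f} \<inter> C"
        by (auto simp: C_def TO_sub_def)
      with opn[of "(a, b)"] 2 show ?thesis
        unfolding openin_subtopology by blast
    qed
  next
    show "rel ` topspace (subtopology P C) \<subseteq> \<Union> (insert (TO S) {TO_sub S a b |a b. a \<in> S \<and> b \<in> S})"
      by (auto simp: C_def)
  qed
  ultimately have "compactin (TO_top S) (rel ` C)"
    by (metis compactin_subtopology image_compactin subset_refl)
  moreover have "rel ` C = TO S"
  proof
    show "TO S \<subseteq> rel ` C"
    proof
      fix r assume r: "r \<in> TO S"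
      \<comment> \<open>The preimage of \<open>r\<close> is its characteristic function, restricted
        because points of the product are extensional on \<open>S \<times> S\<close>.\<close>
      then have "rel (restrict (\<lambda>p. p \<in> r) (S \<times> S)) = r"
        by (auto simp: rel_def TO_iff)
      with r show "r \<in> rel ` C"
        by (intro image_eqI[of _ _ "restrict (\<lambda>p. p \<in> r) (S \<times> S)"]) (simp_all add: C_def topP)
    qed
  qed (auto simp: C_def)
  ultimately show ?thesis
    by (simp add: compact_space_def)
qed

text \<open>Since \<open>r\<close> lies in \<open>A \<times> A\<close>, any pair witnessing
  membership in the transported relation has entries in \<open>A\<close>, so injectivity on
  \<open>A\<close> identifies it with \<open>(a, b)\<close>.\<close>

lemma transport_mem_iff:
  assumes "inj_on f A" "r \<in> TO A" "a \<in> A" "b \<in> A"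
  shows "(f a, f b) \<in> transport f r \<longleftrightarrow> (a, b) \<in> r"
proof
  assume "(f a, f b) \<in> transport f r"
  then obtain a' b' where ab: "f a = f a'" "f b = f b'" "(a', b') \<in> r"
    by (auto simp: transport_def)
  moreover from ab(3) have "a' \<in> A" "b' \<in> A"
    using assms(2) by (auto simp: TO_iff)
  ultimately show "(a, b) \<in> r"
    using assms by (simp add: inj_on_eq_iff)
qed (auto simp: transport_def)

lemma transport_TO:
  assumes "bij_betw f A B" "r \<in> TO A"
  shows "transport f r \<in> TO B"
proof -
  have B: "B = f ` A" and inj: "inj_on f A"
    using assms by (auto simp: bij_betw_def)
  have "transport f r \<subseteq> f ` A \<times> f ` A" "r \<subseteq> A \<times> A"
    using assms(2) by (auto simp: transport_def TO_iff)
  then have "transport f r \<in> TO B \<longleftrightarrow> r \<in> TO A"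
    unfolding TO_iff B ball_simps
    by (simp add: transport_mem_iff[OF inj assms(2)] inj_on_eq_iff[OF inj])
  with assms(2) show ?thesis
    by simp
qed

text \<open>By surjectivity every subbasic set of the target is \<open>TO_sub B (f a) (f b)\<close>
  with \<open>a\<close>, \<open>b\<close> in \<open>A\<close>, and its preimage is
  \<open>TO_sub A a b\<close>.\<close>

lemma continuous_map_transport:
  assumes bij: "bij_betw f A B"
  shows "continuous_map (TO_top A) (TO_top B) (transport f)"
  unfolding TO_top_def[of B]
proof (rule continuous_on_generated_topo)
  fix U
  assume "U \<in> insert (TO B) {TO_sub B a b |a b. a \<in> B \<and> b \<in> B}"
  then consider "U = TO B" | a b where "a \<in> A" "b \<in> A" "U = TO_sub B (f a) (f b)"
    using bij by (auto simp: bij_betw_def)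
  then show "openin (TO_top A) (transport f -` U \<inter> topspace (TO_top A))"
  proof cases
    case 1
    then have "transport f -` U \<inter> topspace (TO_top A) = topspace (TO_top A)"
      using transport_TO[OF bij] by auto
    then show ?thesis
      by (metis openin_topspace)
  next
    case 2
    then have "transport f -` U \<inter> topspace (TO_top A) = TO_sub A a b"
      using transport_TO[OF bij] transport_mem_iff[OF bij_betw_imp_inj_on[OF bij]]
      by (auto simp: TO_sub_def)
    with 2 show ?thesis
      by (simp add: openin_TO_sub)
  qed
next
  show "transport f ` topspace (TO_top A) \<subseteq> \<Union> (insert (TO B) {TO_sub B a b |a b. a \<in> B \<and> b \<in> B})"
    using transport_TO[OF bij] by auto
qed

lemma closedin_AO_M: "closedin (TO_top (monoms t)) (AO_M t)"
proof -
  have mem: "Xpow \<nu> \<in> monoms t" if "\<nu> \<in> exps t" for \<nu>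
    using that by (simp add: monoms_def)
  have "0 \<in> exps t"
    by (simp add: exps_def)
  from mem[OF this] have one: "1 \<in> monoms t"
    by (simp add: Xpow_0)
  have add: "\<nu> + \<gamma> \<in> exps t" if "\<nu> \<in> exps t" "\<gamma> \<in> exps t" for \<nu> \<gamma>
    using that keys_add[of \<nu> \<gamma>] by (auto simp: exps_def)
  show ?thesis
    \<comment> \<open>Translation invariance becomes a disjunction of a non-membership and a
      membership, both closed conditions; \<open>one\<close>, \<open>mem\<close> and
      \<open>add\<close> ensure that the pairs consist of monomials.\<close>
    unfolding AO_M_def imp_conv_disj topspace_TO_top[symmetric]
    by (intro closedin_conj closedin_Ball closedin_disj closedin_TO_mem closedin_TO_not_mem
        one mem add)
qed

theorem proposition6p8:
  fixes scale :: "'k::field \<Rightarrow> 'a::ring \<Rightarrow> 'a"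
    and t :: nat
    and \<Phi> :: "'a \<Rightarrow> 'k mpol"
  assumes "algebra_with_pol_iso scale t \<Phi>"
  shows "closedin (TO_top (monoms t)) (AO_M t :: 'k mpol rel set)
       \<and> closedin (TO_top (basisN t \<Phi>)) (AO_N t \<Phi>)
       \<and> compactin (TO_top (monoms t)) (AO_M t :: 'k mpol rel set)
       \<and> compactin (TO_top (basisN t \<Phi>)) (AO_N t \<Phi>)"
proof -
  have \<Phi>: "bij_betw \<Phi> UNIV (pol_ring t)"
    using assms by (rule algebra_with_pol_iso.bij)
  \<comment> \<open>Every monomial lies in the image of \<open>\<Phi>\<close>, so
    \<open>\<Phi>\<close> maps \<open>basisN t \<Phi>\<close> onto \<open>monoms t\<close>.\<close>
  have "(monoms t :: 'k mpol set) \<subseteq> pol_ring t"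
    by (auto simp: monoms_def pol_ring_def Xpow_def)
  with \<Phi> have "bij_betw \<Phi> (basisN t \<Phi>) (monoms t)"
    by (auto simp: bij_betw_def basisN_def inj_on_def)
  \<comment> \<open>On \<open>TO (basisN t \<Phi>)\<close> the map \<open>transport \<Phi>\<close>
    is the bijection \<phi>, and \<open>AO_N\<close> is by definition the preimage of
    \<open>AO_M\<close> under it.\<close>
  from closedin_continuous_map_preimage[OF continuous_map_transport[OF this] closedin_AO_M]
  have "closedin (TO_top (basisN t \<Phi>)) (AO_N t \<Phi>)"
    by (simp add: AO_N_def)
  then show ?thesis
    by (simp add: closedin_AO_M closedin_compact_space compact_space_TO_top)
qed

end
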